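(* Let $d\in\mathbb{N}$. Every finite union of properties (of graphs of maximum degree at most $d$) defined by $0$-profiles is GSF-local. That is, if $k\in\mathbb{N}$, $r_1,\dots,r_k\in\mathbb{N}$, and $\rho_i$ is a $0$-profile of radius $r_i$ and degree $d$ for graphs for each $1\le i\le k$, then the graph property $\bigcup_{1\le i\le k}\mathcal{P}_{\rho_i}\subseteq\mathcal{C}_d$ is GSF-local.
   Context: Graphs are finite, simple and undirected (possibly empty). For $d\in\mathbb{N}$, $\mathcal{C}_d$ is the class of all graphs of maximum degree at most $d$; all graph properties are isomorphism-closed subsets of $\mathcal{C}_d$. $\mathbb{N}$ includes $0$. Neighbourhood types. For $r\in\mathbb{N}$ and $v\in V(G)$, $N_r^G(v)$ is the set of vertices at distance at most $r$ from $v$ in $G$, and $\mathcal{N}_r^G(v)=G[N_r^G(v)]$ is the induced subgraph. An $r$-ball is a pair $(B,b)$ with $B$ a graph, $b\in V(B)$ and $V(B)=N_r^B(b)$; two $r$-balls are isomorphic if there is a graph isomorphism between them mapping centre to centre. An $r$-type is an isomorphism class of $r$-balls. A vertex $v$ of $G$ has $r$-type $\tau$ if $(\mathcal{N}_r^G(v),v)\in\tau$. Let $n_{d,r}$ be the (finite) number of $r$-types of graphs of degree at most $d$, and fix an enumeration $\tau_{d,r}^1,\dots,\tau_{d,r}^{n_{d,r}}$ of them. The $r$-histogram vector $\overline{v}_{d,r}(G)$ of $G\in\mathcal{C}_d$ has $i$-th entry equal to the number of vertices of $G$ of $r$-type $\tau_{d,r}^i$. $0$-profiles. Let $\mathfrak{I}_0=\{[0,\infty)\}\cup\{[0,k]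 : k\in\mathbb{N}\}$. A $0$-profile of radius $r$ and degree $d$ is a function $\rho:\{1,\dots,n_{d,r}\}\to\mathfrak{I}_0$. The property it defines is $\mathcal{P}_\rho=\{G\in\mathcal{C}_d : (\overline{v}_{d,r}(G))_i\in\rho(i)\text{ for all }1\le i\le n_{d,r}\}$. Generalised subgraph freeness. For a graph $G$, $N_1^G(v)$ is the closed neighbourhood of $v$ ($v$ together with its neighbours). A marked graph is a graph each of whose vertices is marked either `full', `semifull' or `partial'. An embedding of a marked graph $F$ into a graph $G$ is an injective map $f:V(F)\to V(G)$ such that for every $v\in V(F)$: (1) if $v$ is marked `full', then $N_1^G(f(v))=f(N_1^F(v))$; (2) if $v$ is marked `semifull', then $N_1^G(f(v))\cap f(V(F))=f(N_1^F(v))$; (3) if $v$ is marked `partial', then $N_1^G(f(v))\supseteq f(N_1^F(v))$. $G$ is $F$-free if there is no embedding of $F$ into $G$, and $\mathcal{F}$-free, for a set $\mathcal{F}$ of marked graphs, if it is $F$-free for every $F\in\mathcal{F}$. GSF-locality. For a property $\mathcal{P}\subseteq\mathcal{C}_d$ let $\mathcal{P}_n=\{G\in\mathcal{P} : |V(G)|=n\}$. $\mathcal{P}$ is GSF-local if there are a sequence $(\mathcal{F}_n)_{n\in\mathbb{N}}$ of sets of marked graphs and an integer $s$ such that for every $n$ each marked graph in $\mathcal{F}_n$ has size at most $s$, and $\mathcal{P}_n$ equals the set of $n$-vertex graphs (in $\mathcal{C}_d$) that are $\mathcal{F}_n$-free. *)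

theory Defs
  imports
    "Graph_Theory.Pair_Digraph"
    "Graph_Theory.Digraph_Isomorphism"
    "Graph_Theory.Shortest_Path"
    "HOL-Library.FuncSet"
begin

text \<open>
  Finite simple undirected graphs are the symmetric loop-free relations of the locale
  \<^locale>\<open>pair_graph\<close> (the empty graph is included).  Vertices are natural numbers, so that
  every finite graph has an isomorphic copy and isomorphism classes are sets.
\<close>

type_synonym ugraph = "nat pair_pre_digraph"

definition deg_class :: "nat \<Rightarrow> ugraph set" where
  "deg_class d = {G. pair_graph G \<and> (\<forall>v\<in>pverts G. out_degree (with_proj G) v \<le> d)}"

definition gdist :: "ugraph \<Rightarrow> nat \<Rightarrow> nat \<Rightarrow> ereal" where
  "gdist G = wf_digraph.\<mu> (with_proj G) (\<lambda>_. 1)"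

definition nbhd :: "nat \<Rightarrow> ugraph \<Rightarrow> nat \<Rightarrow> nat set" where
  "nbhd r G v = {w \<in> pverts G. gdist G v w \<le> ereal (real r)}"

text \<open>The library's induced subgraph \<open>\<restriction>\<close>, for graphs given by a relation (see
  \<open>with_proj_pinduce\<close> below).\<close>

definition pinduce :: "ugraph \<Rightarrow> nat set \<Rightarrow> ugraph" where
  "pinduce G S = \<lparr> pverts = S, parcs = {e \<in> parcs G. fst e \<in> S \<and> snd e \<in> S} \<rparr>"

type_synonym rooted_graph = "ugraph \<times> nat"

definition rballs :: "nat \<Rightarrow> rooted_graph set" where
  "rballs r = {(B, b). pair_graph B \<and> b \<in> pverts B \<and> pverts B = nbhd r B b}"

definition rooted_iso :: "rooted_graph \<Rightarrow> rooted_graph \<Rightarrow> bool" where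
  "rooted_iso X Y \<longleftrightarrow>
     (\<exists>h. pre_digraph.digraph_isomorphism (with_proj (fst X)) h \<and>
          with_proj (fst Y) = app_iso h (with_proj (fst X)) \<and>
          iso_verts h (snd X) = snd Y)"

definition rball_iso_rel :: "nat \<Rightarrow> rooted_graph rel" where
  "rball_iso_rel r = {(X, Y). X \<in> rballs r \<and> Y \<in> rballs r \<and> rooted_iso X Y}"

definition rtypes :: "nat \<Rightarrow> nat \<Rightarrow> rooted_graph set set" where
  "rtypes d r = {X \<in> rballs r. fst X \<in> deg_class d} // rball_iso_rel r"

definition n_rtypes :: "nat \<Rightarrow> nat \<Rightarrow> nat" where
  "n_rtypes d r = card (rtypes d r)"

text \<open>An arbitrary fixed enumeration; it exists by \<open>bij_betw_rtype_enum\<close> below.\<close>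

definition rtype_enum :: "nat \<Rightarrow> nat \<Rightarrow> nat \<Rightarrow> rooted_graph set" where
  "rtype_enum d r = (SOME \<tau>. bij_betw \<tau> {1..n_rtypes d r} (rtypes d r))"

definition has_rtype :: "nat \<Rightarrow> ugraph \<Rightarrow> nat \<Rightarrow> rooted_graph set \<Rightarrow> bool" where
  "has_rtype r G v \<tau> \<longleftrightarrow> (pinduce G (nbhd r G v), v) \<in> \<tau>"

definition histogram :: "nat \<Rightarrow> nat \<Rightarrow> ugraph \<Rightarrow> nat \<Rightarrow> nat" where
  "histogram d r G i = card {v \<in> pverts G. has_rtype r G v (rtype_enum d r i)}"

text \<open>Histogram entries are natural numbers, so the intervals are taken in \<^typ>\<open>nat\<close>.\<close>

definition zero_intervals :: "nat set set" where
  "zero_intervals = {{0..}} \<union> {{0..k} | k. True}"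

definition zero_profile :: "nat \<Rightarrow> nat \<Rightarrow> (nat \<Rightarrow> nat set) \<Rightarrow> bool" where
  "zero_profile d r \<rho> \<longleftrightarrow> \<rho> \<in> {1..n_rtypes d r} \<rightarrow> zero_intervals"

definition profile_property :: "nat \<Rightarrow> nat \<Rightarrow> (nat \<Rightarrow> nat set) \<Rightarrow> ugraph set" where
  "profile_property d r \<rho> =
     {G \<in> deg_class d. \<forall>i\<in>{1..n_rtypes d r}. histogram d r G i \<in> \<rho> i}"

datatype mark = Full | Semifull | Partial

text \<open>The values of the marking outside the vertex set are irrelevant.\<close>

type_synonym marked_graph = "ugraph \<times> (nat \<Rightarrow> mark)"

definition mark_condition :: "marked_graph \<Rightarrow> ugraph \<Rightarrow> (nat \<Rightarrow> nat) \<Rightarrow> nat \<Rightarrow> bool" where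
  "mark_condition M G f v =
     (let F = fst M in
      case snd M v of
        Full \<Rightarrow> nbhd 1 G (f v) = f ` nbhd 1 F v
      | Semifull \<Rightarrow> nbhd 1 G (f v) \<inter> f ` pverts F = f ` nbhd 1 F v
      | Partial \<Rightarrow> nbhd 1 G (f v) \<supseteq> f ` nbhd 1 F v)"

definition embedding :: "marked_graph \<Rightarrow> ugraph \<Rightarrow> (nat \<Rightarrow> nat) \<Rightarrow> bool" where
  "embedding M G f \<longleftrightarrow>
     f \<in> pverts (fst M) \<rightarrow> pverts G \<and> inj_on f (pverts (fst M)) \<and>
     (\<forall>v\<in>pverts (fst M). mark_condition M G f v)"

definition is_free :: "marked_graph set \<Rightarrow> ugraph \<Rightarrow> bool" where
  "is_free \<F> G \<longleftrightarrow> (\<forall>M\<in>\<F>. \<nexists>f. embedding M G f)"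

text \<open>The size of a marked graph is its number of vertices.  The defining equation forces
  \<open>P\<close> to be an isomorphism-closed subset of \<^term>\<open>deg_class d\<close>.\<close>

definition GSF_local :: "nat \<Rightarrow> ugraph set \<Rightarrow> bool" where
  "GSF_local d P \<longleftrightarrow>
     (\<exists>(\<F> :: nat \<Rightarrow> marked_graph set) (s :: nat). \<forall>n.
        (\<forall>M\<in>\<F> n. pair_graph (fst M) \<and> card (pverts (fst M)) \<le> s) \<and>
        {G \<in> P. card (pverts G) = n} =
          {G \<in> deg_class d. card (pverts G) = n \<and> is_free (\<F> n) G})"


section \<open>Sanity of the definitions\<close>

lemma with_proj_pinduce: "with_proj (pinduce G S) = with_proj G \<restriction> S"
  by (simp add: with_proj_def pinduce_def induce_subgraph_def)

lemma awalk_relpow: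
  assumes "pair_graph G" "v \<in> pverts G"
  shows "(\<exists>p. pre_digraph.awalk (with_proj G) v p w \<and> length p = k) \<longleftrightarrow> (v, w) \<in> parcs G ^^ k"
proof -
  interpret pair_graph G by fact
  show ?thesis using assms(2)
  proof (induction k arbitrary: v)
    case 0 then show ?case by (auto simp: awalk_def)
  next
    case (Suc k)
    show ?case
    proof
      assume "\<exists>p. awalk v p w \<and> length p = Suc k"
      then obtain e p where "awalk v (e # p) w" "length p = k"
        by (metis length_Suc_conv)
      then have "e \<in> parcs G" "fst e = v" "awalk (snd e) p w" "snd e \<in> pverts G"
        by (auto simp: awalk_Cons_iff)
      with Suc.IH[of "snd e"] \<open>length p = k\<close> show "(v, w) \<in> parcs G ^^ Suc k"
        by (metis prod.collapse relpow_Suc_I2)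
    next
      assume "(v, w) \<in> parcs G ^^ Suc k"
      then obtain u where u: "(v, u) \<in> parcs G" "(u, w) \<in> parcs G ^^ k"
        by (meson relpow_Suc_D2)
      then have "u \<in> pverts G" by (auto dest: in_arcsD2)
      with u Suc.IH obtain p where "awalk u p w" "length p = k" by blast
      with u Suc.prems have "awalk v ((v,u) # p) w" by (simp add: awalk_Cons_iff)
      with \<open>length p = k\<close> show "\<exists>p. awalk v p w \<and> length p = Suc k"
        by (metis length_Cons)
    qed
  qed
qed

lemma nbhd_relpow:
  assumes "pair_graph G" "v \<in> pverts G"
  shows "nbhd r G v = {w \<in> pverts G. \<exists>k\<le>r. (v, w) \<in> parcs G ^^ k}"
proof -
  interpret pair_graph G by fact
  have cost: "awalk_cost (\<lambda>_. 1) p = real (length p)" for p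
    by (induction p) auto
  have "gdist G v w \<le> ereal (real r) \<longleftrightarrow> (\<exists>k\<le>r. (v, w) \<in> parcs G ^^ k)" for w
  proof
    assume "gdist G v w \<le> ereal (real r)"
    then have "(INF p\<in>{p. awalk v p w}. ereal (awalk_cost (\<lambda>_. 1) p)) < ereal (real r + 1)"
      unfolding gdist_def \<mu>_def by (rule le_less_trans) simp
    then obtain p where "awalk v p w" "length p < r + 1"
      unfolding INF_less_iff by (auto simp: cost)
    then show "\<exists>k\<le>r. (v, w) \<in> parcs G ^^ k"
      using awalk_relpow[OF assms] by (metis less_Suc_eq_le Suc_eq_plus1)
  next
    assume "\<exists>k\<le>r. (v, w) \<in> parcs G ^^ k"
    then obtain p where "awalk v p w" "length p \<le> r"
      using awalk_relpow[OF assms] by metis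
    then show "gdist G v w \<le> ereal (real r)"
      unfolding gdist_def using min_cost_le_walk_cost[of v p w "\<lambda>_. 1"]
      by (auto simp: cost intro: order_trans)
  qed
  then show ?thesis by (simp add: nbhd_def)
qed

lemma nbhd_1:
  assumes "pair_graph G" "v \<in> pverts G"
  shows "nbhd 1 G v = insert v {w. (v, w) \<in> parcs G}"
proof -
  interpret pair_graph G by fact
  have "(\<exists>k\<le>1. (v, w) \<in> parcs G ^^ k) \<longleftrightarrow> w = v \<or> (v, w) \<in> parcs G" for w
    by (auto simp: le_Suc_eq)
  then show ?thesis using assms by (auto simp: nbhd_relpow dest: in_arcsD2)
qed

lemma rooted_iso_iff:
  assumes "pair_graph A" "pair_graph B"
  shows "rooted_iso (A, a) (B, b) \<longleftrightarrow>
     (\<exists>f. inj_on f (pverts A) \<and> pverts B = f ` pverts A \<and>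
          parcs B = map_prod f f ` parcs A \<and> f a = b)"
proof -
  interpret A: pair_graph A by fact
  interpret B: pair_graph B by fact
  show ?thesis
  proof
    assume "rooted_iso (A, a) (B, b)"
    then obtain h where h: "A.digraph_isomorphism h"
      "with_proj B = app_iso h (with_proj A)" "iso_verts h a = b"
      by (auto simp: rooted_iso_def)
    from h(2) have eqs: "pverts B = iso_verts h ` pverts A" "parcs B = iso_arcs h ` parcs A"
      "iso_tail h = fst" "iso_head h = snd"
      by (auto simp: app_iso_def with_proj_def)
    have "iso_arcs h e = map_prod (iso_verts h) (iso_verts h) e" if "e \<in> parcs A" for e
      using h(1) that eqs by (auto simp: A.digraph_isomorphism_def prod_eq_iff)
    then have "iso_arcs h ` parcs A = map_prod (iso_verts h) (iso_verts h) ` parcs A"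
      by (intro image_cong) auto
    with h eqs show "\<exists>f. inj_on f (pverts A) \<and> pverts B = f ` pverts A \<and>
          parcs B = map_prod f f ` parcs A \<and> f a = b"
      by (intro exI[of _ "iso_verts h"]) (auto simp: A.digraph_isomorphism_def)
  next
    assume "\<exists>f. inj_on f (pverts A) \<and> pverts B = f ` pverts A \<and>
          parcs B = map_prod f f ` parcs A \<and> f a = b"
    then obtain f where f: "inj_on f (pverts A)" "pverts B = f ` pverts A"
      "parcs B = map_prod f f ` parcs A" "f a = b" by blast
    let ?h = "\<lparr> iso_verts = f, iso_arcs = map_prod f f, iso_head = snd, iso_tail = fst \<rparr>"
    have "inj_on (map_prod f f) (parcs A)"
      by (rule inj_on_subset[OF map_prod_inj_on[OF f(1) f(1)]])
         (auto dest: A.in_arcsD1 A.in_arcsD2)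
    then have "A.digraph_isomorphism ?h"
      using f(1) by (auto simp: A.digraph_isomorphism_def A.wf_digraph)
    moreover have "with_proj B = app_iso ?h (with_proj A)"
      using f by (simp add: app_iso_def with_proj_def)
    ultimately show "rooted_iso (A, a) (B, b)"
      using f(4) unfolding rooted_iso_def by (intro exI[of _ ?h]) simp
  qed
qed


lemma relpow_map_prod:
  assumes "inj_on f S" "R \<subseteq> S \<times> S" "u \<in> S" "v \<in> S"
  shows "(f u, f v) \<in> (map_prod f f ` R) ^^ k \<longleftrightarrow> (u, v) \<in> R ^^ k"
  using assms(4)
proof (induction k arbitrary: v)
  case 0
  then show ?case using assms by (auto dest: inj_onD)
next
  case (Suc k)
  have "(f u, f v) \<in> (map_prod f f ` R) ^^ Suc k \<longleftrightarrow>
        (\<exists>y. (f u, y) \<in> (map_prod f f ` R) ^^ k \<and> (y, f v) \<in> map_prod f f ` R)"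
    by (auto simp: relcomp_unfold)
  also have "\<dots> \<longleftrightarrow> (\<exists>w\<in>S. (f u, f w) \<in> (map_prod f f ` R) ^^ k \<and> (w, v) \<in> R)"
    using assms Suc.prems by (force dest: inj_onD)
  also have "\<dots> \<longleftrightarrow> (\<exists>w\<in>S. (u, w) \<in> R ^^ k \<and> (w, v) \<in> R)"
    using Suc.IH by blast
  also have "\<dots> \<longleftrightarrow> (u, v) \<in> R ^^ Suc k"
    using assms(2) by (auto simp: relcomp_unfold)
  finally show ?case .
qed

lemma parcs_subset: "pair_graph G \<Longrightarrow> parcs G \<subseteq> pverts G \<times> pverts G"
  by (auto simp: pair_graph_def pair_digraph_def pair_fin_digraph_def pair_wf_digraph_def)

lemma pair_graph_iff:
  "pair_graph G \<longleftrightarrow> finite (pverts G) \<and> parcs G \<subseteq> pverts G \<times> pverts G \<and>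
     sym (parcs G) \<and> (\<forall>v. (v, v) \<notin> parcs G)"
proof
  assume "pair_graph G"
  then interpret pair_graph G .
  show "finite (pverts G) \<and> parcs G \<subseteq> pverts G \<times> pverts G \<and>
     sym (parcs G) \<and> (\<forall>v. (v, v) \<notin> parcs G)"
    using pair_sym_arcs pair_no_loops pair_finite_verts parcs_subset[OF pair_graph_axioms]
    by (fastforce simp: symmetric_def)
next
  assume *: "finite (pverts G) \<and> parcs G \<subseteq> pverts G \<times> pverts G \<and>
     sym (parcs G) \<and> (\<forall>v. (v, v) \<notin> parcs G)"
  then have "finite (parcs G)" by (meson finite_SigmaI finite_subset)
  with * show "pair_graph G"
    by unfold_locales (auto simp: symmetric_def)
qed

lemma rball_image:
  assumes "(A, a) \<in> rballs r" "inj_on f (pverts A)"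
  shows "(\<lparr> pverts = f ` pverts A, parcs = map_prod f f ` parcs A \<rparr>, f a) \<in> rballs r"
    (is "(?B, _) \<in> _")
proof -
  have A: "pair_graph A" "a \<in> pverts A" "pverts A = nbhd r A a"
    using assms(1) by (auto simp: rballs_def)
  have sub: "parcs A \<subseteq> pverts A \<times> pverts A" by (rule parcs_subset) fact
  have B: "pair_graph ?B"
    unfolding pair_graph_iff
  proof (intro conjI allI)
    show "finite (pverts ?B)" using A(1) by (simp add: pair_graph_iff)
    show "parcs ?B \<subseteq> pverts ?B \<times> pverts ?B" using sub by auto
    show "sym (parcs ?B)"
    proof (rule symI)
      fix x y assume "(x, y) \<in> parcs ?B"
      then obtain u v where "(u, v) \<in> parcs A" "x = f u" "y = f v" by auto
      moreover from this have "(v, u) \<in> parcs A"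
        using A(1) by (auto simp: pair_graph_iff dest: symD)
      ultimately show "(y, x) \<in> parcs ?B" by (auto intro: rev_image_eqI)
    qed
    show "(x, x) \<notin> parcs ?B" for x
    proof
      assume "(x, x) \<in> parcs ?B"
      then obtain u v where uv: "(u, v) \<in> parcs A" "f u = f v" by auto
      with sub have "u = v" by (auto intro: inj_onD[OF assms(2)])
      with uv(1) A(1) show False by (simp add: pair_graph_iff)
    qed
  qed
  have "pverts ?B = nbhd r ?B (f a)"
  proof -
    have fa: "f a \<in> pverts ?B" using A(2) by simp
    have "\<exists>k\<le>r. (f a, x) \<in> parcs ?B ^^ k" if "x \<in> pverts ?B" for x
    proof -
      from that obtain w where w: "w \<in> pverts A" "x = f w" by auto
      then have "w \<in> nbhd r A a" using A(3) by blast
      then obtain k where "k \<le> r" "(a, w) \<in> parcs A ^^ k"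
        unfolding nbhd_relpow[OF A(1,2)] by blast
      moreover from this(2) have "(f a, f w) \<in> parcs ?B ^^ k"
        unfolding pair_pre_digraph.simps
        by (rule relpow_map_prod[OF assms(2) sub A(2) w(1), THEN iffD2])
      ultimately show ?thesis using w(2) by blast
    qed
    then show ?thesis unfolding nbhd_relpow[OF B fa] by blast
  qed
  moreover have "f a \<in> pverts ?B" using A(2) by simp
  ultimately show ?thesis
    unfolding rballs_def mem_Collect_eq prod.case using B by (intro conjI)
qed

lemma equiv_rball_iso_rel: "equiv (rballs r) (rball_iso_rel r)"
proof (rule equivI)
  have *: "pair_graph (fst X)" if "X \<in> rballs r" for X
    using that by (auto simp: rballs_def)
  show "rball_iso_rel r \<subseteq> rballs r \<times> rballs r"
    by (auto simp: rball_iso_rel_def)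
  show "refl_on (rballs r) (rball_iso_rel r)"
  proof (rule refl_onI)
    fix X assume "X \<in> rballs r"
    moreover from this have "rooted_iso X X"
      using rooted_iso_iff[OF *[of X] *[of X], of "snd X" "snd X"]
      by (auto intro!: exI[of _ id] simp: prod.map_id0)
    ultimately show "(X, X) \<in> rball_iso_rel r" by (simp add: rball_iso_rel_def)
  qed
  show "sym (rball_iso_rel r)"
  proof (rule symI)
    fix X Y assume XY: "(X, Y) \<in> rball_iso_rel r"
    obtain A a B b where [simp]: "X = (A, a)" "Y = (B, b)" by (metis surj_pair)
    have g: "pair_graph A" "pair_graph B" "a \<in> pverts A" and r: "rooted_iso (A, a) (B, b)"
      using XY by (auto simp: rball_iso_rel_def rballs_def)
    from r obtain f where f: "inj_on f (pverts A)" "pverts B = f ` pverts A"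
      "parcs B = map_prod f f ` parcs A" "f a = b"
      unfolding rooted_iso_iff[OF g(1,2)] by blast
    let ?g = "the_inv_into (pverts A) f"
    have inv: "?g (f x) = x" if "x \<in> pverts A" for x
      using f(1) that by (rule the_inv_into_f_f)
    have "map_prod ?g ?g (map_prod f f e) = e" if "e \<in> parcs A" for e
      using parcs_subset[OF g(1)] that inv by (cases e) auto
    then have "map_prod ?g ?g ` parcs B = parcs A"
      unfolding f(3) image_image by simp
    moreover have "?g ` pverts B = pverts A"
      unfolding f(2) image_image using inv by simp
    moreover have "inj_on ?g (pverts B)"
      unfolding f(2) by (rule inj_on_the_inv_into) (rule f(1))
    moreover have "?g b = a" using inv[OF g(3)] f(4) by simp
    ultimately have "rooted_iso (B, b) (A, a)"
      unfolding rooted_iso_iff[OF g(2,1)] by (intro exI[of _ ?g]) simp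
    then show "(Y, X) \<in> rball_iso_rel r" using XY by (simp add: rball_iso_rel_def)
  qed
  show "trans (rball_iso_rel r)"
  proof (rule transI)
    fix X Y Z assume XY: "(X, Y) \<in> rball_iso_rel r" and YZ: "(Y, Z) \<in> rball_iso_rel r"
    obtain A a B b C c where [simp]: "X = (A, a)" "Y = (B, b)" "Z = (C, c)"
      by (metis surj_pair)
    have g: "pair_graph A" "pair_graph B" "pair_graph C"
      and r: "rooted_iso (A, a) (B, b)" "rooted_iso (B, b) (C, c)"
      using XY YZ by (auto simp: rball_iso_rel_def rballs_def)
    from r(1) obtain f where f: "inj_on f (pverts A)" "pverts B = f ` pverts A"
      "parcs B = map_prod f f ` parcs A" "f a = b"
      unfolding rooted_iso_iff[OF g(1,2)] by blast
    from r(2) obtain h where h: "inj_on h (pverts B)" "pverts C = h ` pverts B"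
      "parcs C = map_prod h h ` parcs B" "h b = c"
      unfolding rooted_iso_iff[OF g(2,3)] by blast
    have "rooted_iso (A, a) (C, c)"
      unfolding rooted_iso_iff[OF g(1,3)]
    proof (intro exI conjI)
      show "inj_on (h \<circ> f) (pverts A)" using f h by (simp add: comp_inj_on)
      show "pverts C = (h \<circ> f) ` pverts A" using f h by (simp add: image_comp)
      show "parcs C = map_prod (h \<circ> f) (h \<circ> f) ` parcs A"
        unfolding h(3) f(3) image_comp map_prod.comp ..
      show "(h \<circ> f) a = c" using f h by simp
    qed
    then show "(X, Z) \<in> rball_iso_rel r" using XY YZ by (simp add: rball_iso_rel_def)
  qed
qed

lemma card_nbhd_le:
  assumes "G \<in> deg_class d" "v \<in> pverts G"
  shows "card (nbhd r G v) \<le> Suc d ^ r"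
proof -
  have G: "pair_graph G" using assms by (simp add: deg_class_def)
  interpret pair_graph G by fact
  have fin: "finite (nbhd k G w)" for k w
    by (rule finite_subset[OF _ pair_finite_verts]) (auto simp: nbhd_def)
  have step: "nbhd (Suc k) G v \<subseteq> (\<Union>w\<in>nbhd k G v. nbhd 1 G w)" for k
  proof
    fix u assume "u \<in> nbhd (Suc k) G v"
    then obtain j where j: "j \<le> Suc k" "(v, u) \<in> parcs G ^^ j" "u \<in> pverts G"
      using assms(2) G by (auto simp: nbhd_relpow)
    show "u \<in> (\<Union>w\<in>nbhd k G v. nbhd 1 G w)"
    proof (cases j)
      case 0
      with j have "u = v" by simp
      moreover have "v \<in> nbhd k G v"
        using assms(2) G by (auto simp: nbhd_relpow intro!: exI[of _ 0])
      ultimately show ?thesis using assms(2) G nbhd_1 by blast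
    next
      case (Suc i)
      with j obtain w where w: "(v, w) \<in> parcs G ^^ i" "(w, u) \<in> parcs G"
        by auto
      then have "w \<in> pverts G" by (auto dest: in_arcsD1)
      moreover have "i \<le> k" using j(1) Suc by simp
      ultimately have "w \<in> nbhd k G v" "u \<in> nbhd 1 G w"
        using assms(2) G w j(3) by (auto simp: nbhd_relpow nbhd_1[unfolded One_nat_def])
      then show ?thesis by blast
    qed
  qed
  have one: "card (nbhd 1 G w) \<le> Suc d" if "w \<in> pverts G" for w
  proof -
    have "{u. (w, u) \<in> parcs G} = snd ` out_arcs (with_proj G) w"
      by (force simp: out_arcs_def)
    then have "card {u. (w, u) \<in> parcs G} \<le> out_degree (with_proj G) w"
      unfolding out_degree_def
      by (metis card_image_le finite_out_arcs)
    also have "\<dots> \<le> d" using assms(1) that by (simp add: deg_class_def)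
    finally have "card {u. (w, u) \<in> parcs G} \<le> d" .
    then show ?thesis
      unfolding nbhd_1[OF G that] by (intro card_insert_le_m1) simp_all
  qed
  show ?thesis
  proof (induction r)
    case 0
    have "nbhd 0 G v = {v}" using assms(2) G by (auto simp: nbhd_relpow)
    then show ?case by simp
  next
    case (Suc k)
    have "card (nbhd (Suc k) G v) \<le> card (\<Union>w\<in>nbhd k G v. nbhd 1 G w)"
      using step fin by (intro card_mono) auto
    also have "\<dots> \<le> (\<Sum>w\<in>nbhd k G v. card (nbhd 1 G w))"
      by (rule card_UN_le[OF fin])
    also have "\<dots> \<le> card (nbhd k G v) * Suc d"
      using sum_bounded_above[of "nbhd k G v" "\<lambda>w. card (nbhd 1 G w)" "Suc d"] one
      by (auto simp: nbhd_def)
    also have "\<dots> \<le> Suc d ^ k * Suc d" using Suc.IH by (rule mult_right_mono) simp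
    finally show ?case by (simp add: mult.commute)
  qed
qed

lemma finite_rtypes: "finite (rtypes d r)"
proof -
  define N where "N = Suc d ^ r"
  define U :: "rooted_graph set" where
    "U = (\<lambda>(V, E, h). (\<lparr> pverts = V, parcs = E \<rparr>, h)) `
           (Pow {..<N} \<times> Pow ({..<N} \<times> {..<N}) \<times> {..<N})"
  have "finite U" by (simp add: U_def)
  moreover have "rtypes d r \<subseteq> (\<lambda>X. rball_iso_rel r `` {X}) ` U"
  proof
    fix \<tau> assume "\<tau> \<in> rtypes d r"
    then obtain A a where A: "(A, a) \<in> rballs r" "A \<in> deg_class d"
      and \<tau>: "\<tau> = rball_iso_rel r `` {(A, a)}"
      by (auto simp: rtypes_def quotient_def)
    then have g: "pair_graph A" "a \<in> pverts A" "pverts A = nbhd r A a"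
      by (auto simp: rballs_def)
    interpret pair_graph A by fact
    have card: "card (pverts A) \<le> N"
      using card_nbhd_le[OF A(2) g(2), of r] g(3) by (simp add: N_def)
    obtain f where f: "bij_betw f (pverts A) {0..<card (pverts A)}"
      using ex_bij_betw_finite_nat[OF pair_finite_verts] by blast
    then have inj: "inj_on f (pverts A)" and im: "f ` pverts A \<subseteq> {..<N}"
      using card by (auto simp: bij_betw_def)
    let ?B = "\<lparr> pverts = f ` pverts A, parcs = map_prod f f ` parcs A \<rparr>"
    have B: "(?B, f a) \<in> rballs r" by (rule rball_image[OF A(1) inj])
    then have gB: "pair_graph ?B" by (auto simp: rballs_def)
    have "map_prod f f ` parcs A \<subseteq> {..<N} \<times> {..<N}"
      using parcs_subset[OF g(1)] im by auto
    then have "(?B, f a) \<in> U"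
      using im g(2) unfolding U_def
      by (intro image_eqI[of _ _ "(f ` pverts A, map_prod f f ` parcs A, f a)"]) auto
    moreover have "rooted_iso (A, a) (?B, f a)"
      unfolding rooted_iso_iff[OF g(1) gB] using inj by (intro exI[of _ f]) simp
    then have "((A, a), (?B, f a)) \<in> rball_iso_rel r"
      using A B by (simp add: rball_iso_rel_def)
    then have "\<tau> = rball_iso_rel r `` {(?B, f a)}"
      unfolding \<tau> by (rule equiv_class_eq[OF equiv_rball_iso_rel])
    ultimately show "\<tau> \<in> (\<lambda>X. rball_iso_rel r `` {X}) ` U" by blast
  qed
  ultimately show ?thesis by (rule finite_surj)
qed

lemma bij_betw_rtype_enum: "bij_betw (rtype_enum d r) {1..n_rtypes d r} (rtypes d r)"
  unfolding rtype_enum_def n_rtypes_def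
  using ex_bij_betw_nat_finite_1[OF finite_rtypes] by (rule someI_ex)

end

theory Submission
  imports Defs
begin

text \<open>
  If \<open>G\<close> violates all of the 0-profiles, then for each of them some type has too many vertices.
  Select just enough of these vertices and let \<open>S\<close> be the union of the balls around them; the size
  of \<open>S\<close> is bounded in terms of \<open>d\<close> and the profiles only.  Mark the vertices of \<open>G[S]\<close> whose
  neighbours all lie in \<open>S\<close> as full and the others as semifull.  An embedding of this marked graph
  into \<open>G'\<close> preserves the type of every selected vertex, so \<open>G'\<close> violates all the profiles too.
  Hence one can forbid all marked graphs of bounded size that embed into no graph with the property.
\<close>

section \<open>Balls built up from closed neighbourhoods\<close>

lemma nbhd_self: "pair_graph G \<Longrightarrow> v \<in> pverts G \<Longrightarrow> v \<in> nbhd r G v"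
  by (auto simp: nbhd_relpow intro!: exI[of _ 0])

lemma nbhd_subset_pverts: "nbhd r G v \<subseteq> pverts G"
  by (auto simp: nbhd_def)

text \<open>Split the last arc off a walk, or append one. The marks constrain closed neighbourhoods
  only, so larger balls must be reduced to these.\<close>

lemma nbhd_Suc:
  assumes G: "pair_graph G" and v: "v \<in> pverts G"
  shows "nbhd (Suc r) G v = (\<Union>w\<in>nbhd r G v. nbhd 1 G w)"
proof (intro set_eqI iffI)
  fix u assume "u \<in> nbhd (Suc r) G v"
  then obtain j where j: "j \<le> Suc r" "(v, u) \<in> parcs G ^^ j" "u \<in> pverts G"
    using v G by (auto simp: nbhd_relpow)
  show "u \<in> (\<Union>w\<in>nbhd r G v. nbhd 1 G w)"
  proof (cases j)
    case 0
    with j show ?thesis using nbhd_self[OF G v] by auto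
  next
    case (Suc i)
    with j obtain w where w: "(v, w) \<in> parcs G ^^ i" "(w, u) \<in> parcs G"
      by auto
    then have wG: "w \<in> pverts G" using parcs_subset[OF G] by auto
    with j Suc w v G have "w \<in> nbhd r G v" by (auto simp: nbhd_relpow)
    moreover have "u \<in> nbhd 1 G w" using nbhd_1[OF G wG] w(2) by auto
    ultimately show ?thesis by blast
  qed
next
  fix u assume "u \<in> (\<Union>w\<in>nbhd r G v. nbhd 1 G w)"
  then obtain w where w: "w \<in> nbhd r G v" "u \<in> nbhd 1 G w" by blast
  then have wG: "w \<in> pverts G" "u \<in> pverts G" using nbhd_subset_pverts by blast+
  obtain i where i: "i \<le> r" "(v, w) \<in> parcs G ^^ i"
    using w(1) nbhd_relpow[OF G v] by auto
  have "u = w \<or> (w, u) \<in> parcs G" using w(2) nbhd_1[OF G wG(1)] by auto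
  then have "\<exists>k\<le>Suc r. (v, u) \<in> parcs G ^^ k"
  proof
    assume "u = w"
    with i show ?thesis by (auto intro: le_SucI)
  next
    assume "(w, u) \<in> parcs G"
    with i show ?thesis by (intro exI[of _ "Suc i"]) auto
  qed
  then show "u \<in> nbhd (Suc r) G v" using wG nbhd_relpow[OF G v] by auto
qed

section \<open>Induced subgraphs as marked graphs\<close>

lemma pverts_pinduce [simp]: "pverts (pinduce G S) = S"
  and parcs_pinduce: "parcs (pinduce G S) = {e \<in> parcs G. fst e \<in> S \<and> snd e \<in> S}"
  by (simp_all add: pinduce_def)

lemma pair_graph_pinduce:
  assumes "pair_graph G" "S \<subseteq> pverts G"
  shows "pair_graph (pinduce G S)"
  using assms unfolding pair_graph_iff
  by (auto simp: parcs_pinduce sym_def intro: finite_subset)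

text \<open>A single arc between vertices of \<open>S\<close> survives in the induced subgraph. For
  larger radii equality can fail, since shortest paths may leave \<open>S\<close>.\<close>

lemma nbhd_1_pinduce:
  assumes "pair_graph G" "S \<subseteq> pverts G" "v \<in> S"
  shows "nbhd 1 (pinduce G S) v = nbhd 1 G v \<inter> S"
  using assms nbhd_1[OF assms(1), of v] nbhd_1[OF pair_graph_pinduce[OF assms(1,2)], of v]
  by (auto simp: parcs_pinduce)

text \<open>\<open>Semifull\<close> rather than \<open>Partial\<close> makes embeddings reflect arcs
  as well as preserve them; \<open>Full\<close> keeps the image of a vertex from acquiring new
  neighbours.\<close>

definition marked_part :: "ugraph \<Rightarrow> nat set \<Rightarrow> marked_graph" where
  "marked_part G S = (pinduce G S, \<lambda>v. if nbhd 1 G v \<subseteq> S then Full else Semifull)"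

text \<open>Cutting down to \<open>S\<close> removes no neighbour of a full vertex. Thus
  \<open>G\<close> contains its own marked part and is not free of it.\<close>

lemma embedding_marked_part_id:
  assumes "pair_graph G" "S \<subseteq> pverts G"
  shows "embedding (marked_part G S) G id"
  using assms by (auto simp: embedding_def marked_part_def mark_condition_def nbhd_1_pinduce
      simp del: One_nat_def)

section \<open>What an embedding of a marked part preserves\<close>

context
  fixes G H :: ugraph and S :: "nat set" and f :: "nat \<Rightarrow> nat"
  assumes G: "pair_graph G" and H: "pair_graph H" and S: "S \<subseteq> pverts G"
    and f: "embedding (marked_part G S) H f"
begin

lemma embedding_inj: "inj_on f S"
  and embedding_verts: "v \<in> S \<Longrightarrow> f v \<in> pverts H"
  using f by (auto simp: embedding_def marked_part_def)

text \<open>The condition for \<open>Full\<close> implies the one for \<open>Semifull\<close>, so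
  the first equation holds under either mark.\<close>

lemma embedding_nbhd_1:
  assumes "v \<in> S"
  shows "nbhd 1 H (f v) \<inter> f ` S = f ` (nbhd 1 G v \<inter> S)"
    and "nbhd 1 G v \<subseteq> S \<Longrightarrow> nbhd 1 H (f v) = f ` nbhd 1 G v"
proof -
  have m: "mark_condition (marked_part G S) H f v"
    using f assms by (auto simp: embedding_def marked_part_def)
  note [simp del] = One_nat_def
  show "nbhd 1 H (f v) \<inter> f ` S = f ` (nbhd 1 G v \<inter> S)"
    using m assms nbhd_1_pinduce[OF G S assms]
    by (auto simp: marked_part_def mark_condition_def split: if_splits)
  show "nbhd 1 H (f v) = f ` nbhd 1 G v" if "nbhd 1 G v \<subseteq> S"
    using m that nbhd_1_pinduce[OF G S assms]
    by (simp add: marked_part_def mark_condition_def Int_absorb2)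
qed

lemma embedding_arcs:
  assumes "u \<in> S" "v \<in> S"
  shows "(f u, f v) \<in> parcs H \<longleftrightarrow> (u, v) \<in> parcs G"
proof (cases "u = v")
  case True
  \<comment> \<open>Closed neighbourhoods contain their centre and say nothing about loops; here
    both sides are false.\<close>
  then show ?thesis using G H by (auto simp: pair_graph_iff)
next
  case False
  then have ne: "f u \<noteq> f v" using assms embedding_inj by (auto dest: inj_onD)
  have "(f u, f v) \<in> parcs H \<longleftrightarrow> f v \<in> nbhd 1 H (f u) \<inter> f ` S"
    using nbhd_1[OF H embedding_verts[OF assms(1)]] ne assms by auto
  also have "\<dots> \<longleftrightarrow> f v \<in> f ` (nbhd 1 G u \<inter> S)"
    unfolding embedding_nbhd_1(1)[OF assms(1)] ..
  also have "\<dots> \<longleftrightarrow> v \<in> nbhd 1 G u \<inter> S"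
    using inj_on_image_mem_iff[OF embedding_inj assms(2), of "nbhd 1 G u \<inter> S"] by simp
  also have "\<dots> \<longleftrightarrow> (u, v) \<in> parcs G"
    using nbhd_1[OF G, of u] S assms False by auto
  finally show ?thesis .
qed

text \<open>Induction on the radius: only vertices at distance less than \<open>r\<close> from
  \<open>v\<close> need to be full, and they are because the \<open>r\<close>-ball lies in
  \<open>S\<close>.\<close>

lemma embedding_nbhd:
  assumes "v \<in> S" "nbhd r G v \<subseteq> S"
  shows "nbhd r H (f v) = f ` nbhd r G v"
  using assms(2)
proof (induction r)
  case 0
  show ?case using assms(1) S embedding_verts G H by (auto simp: nbhd_relpow)
next
  case (Suc r)
  have v: "v \<in> pverts G" using assms(1) S by blast
  have sub: "nbhd 1 G w \<subseteq> S" if "w \<in> nbhd r G v" for w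
    using Suc.prems that unfolding nbhd_Suc[OF G v] by blast
  have mem: "w \<in> nbhd 1 G w" if "w \<in> nbhd r G v" for w
    using that nbhd_subset_pverts nbhd_self[OF G] by blast
  have S': "nbhd r G v \<subseteq> S" using sub mem by blast
  have "nbhd (Suc r) H (f v) = (\<Union>w\<in>nbhd r G v. nbhd 1 H (f w))"
    using nbhd_Suc[OF H embedding_verts[OF assms(1)]] Suc.IH[OF S'] by simp
  also have "\<dots> = (\<Union>w\<in>nbhd r G v. f ` nbhd 1 G w)"
    using embedding_nbhd_1(2) sub S' by (intro SUP_cong) blast+
  also have "\<dots> = f ` nbhd (Suc r) G v"
    unfolding nbhd_Suc[OF G v] by blast
  finally show ?case .
qed

text \<open>\<open>f\<close> restricts to an isomorphism between the balls around \<open>v\<close>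
  and \<open>f v\<close>, and a type is a full isomorphism class.\<close>

lemma embedding_has_rtype:
  assumes "\<tau> \<in> rtypes d r" "v \<in> S" "nbhd r G v \<subseteq> S" "has_rtype r G v \<tau>"
  shows "has_rtype r H (f v) \<tau>"
proof -
  define A where "A = pinduce G (nbhd r G v)"
  define B where "B = pinduce H (nbhd r H (f v))"
  obtain X where \<tau>: "\<tau> = rball_iso_rel r `` {X}"
    using assms(1) by (auto simp: rtypes_def quotient_def)
  have A\<tau>: "(X, (A, v)) \<in> rball_iso_rel r"
    using assms(4) by (simp add: has_rtype_def A_def \<tau>)
  \<comment> \<open>Membership in a type already certifies an \<open>r\<close>-ball, so distances
    inside the induced subgraph need not be computed.\<close>
  then have A: "(A, v) \<in> rballs r" by (simp add: rball_iso_rel_def)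
  have inj: "inj_on f (pverts A)"
    using inj_on_subset[OF embedding_inj assms(3)] by (simp add: A_def)
  have "parcs B = map_prod f f ` parcs A"
  proof -
    have "parcs B = {(f x, f y) | x y. x \<in> nbhd r G v \<and> y \<in> nbhd r G v \<and> (f x, f y) \<in> parcs H}"
      unfolding B_def parcs_pinduce embedding_nbhd[OF assms(2,3)] by force
    also have "\<dots> = {(f x, f y) | x y. x \<in> nbhd r G v \<and> y \<in> nbhd r G v \<and> (x, y) \<in> parcs G}"
      using embedding_arcs assms(3) by blast
    also have "\<dots> = map_prod f f ` parcs A"
      unfolding A_def parcs_pinduce by force
    finally show ?thesis .
  qed
  then have B_eq: "B = \<lparr> pverts = f ` pverts A, parcs = map_prod f f ` parcs A \<rparr>"
    using embedding_nbhd[OF assms(2,3)] by (simp add: A_def B_def pinduce_def)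
  have B: "(B, f v) \<in> rballs r"
    unfolding B_eq by (rule rball_image[OF A inj])
  have "pair_graph A" "pair_graph B" using A B by (auto simp: rballs_def)
  then have "rooted_iso (A, v) (B, f v)"
    using inj by (auto simp: rooted_iso_iff B_eq)
  then have "((A, v), (B, f v)) \<in> rball_iso_rel r"
    using A B by (simp add: rball_iso_rel_def)
  with A\<tau> have "(X, (B, f v)) \<in> rball_iso_rel r"
    using equiv_rball_iso_rel[of r] by (blast elim: equivE dest: transD)
  then show ?thesis by (simp add: has_rtype_def B_def \<tau>)
qed

lemma embedding_card_le_histogram:
  assumes "j \<in> {1..n_rtypes d r}" "W \<subseteq> S"
    and "\<And>w. w \<in> W \<Longrightarrow> nbhd r G w \<subseteq> S \<and> has_rtype r G w (rtype_enum d r j)"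
  shows "card W \<le> histogram d r H j"
proof -
  have \<tau>: "rtype_enum d r j \<in> rtypes d r"
    using bij_betw_apply[OF bij_betw_rtype_enum assms(1)] .
  have "card W = card (f ` W)"
    using card_image[OF inj_on_subset[OF embedding_inj assms(2)]] by simp
  also have "\<dots> \<le> histogram d r H j"
    unfolding histogram_def
  proof (rule card_mono)
    show "finite {v \<in> pverts H. has_rtype r H v (rtype_enum d r j)}"
      using H by (simp add: pair_graph_iff)
    show "f ` W \<subseteq> {v \<in> pverts H. has_rtype r H v (rtype_enum d r j)}"
      using embedding_has_rtype[OF \<tau>] embedding_verts assms by blast
  qed
  finally show ?thesis .
qed

end

lemma not_in_zero_interval_iff:
  "I \<in> zero_intervals \<Longrightarrow> n \<notin> I \<longleftrightarrow> finite I \<and> card I \<le> n"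
  \<comment> \<open>The interval \<open>{0..k}\<close> has \<open>k + 1\<close> elements, the least
    number outside it; finiteness rules out the unbounded interval.\<close>
  by (auto simp: zero_intervals_def)

lemma not_in_profile_property_iff:
  assumes "zero_profile d r \<rho>" "G \<in> deg_class d"
  shows "G \<notin> profile_property d r \<rho> \<longleftrightarrow>
    (\<exists>j\<in>{1..n_rtypes d r}. finite (\<rho> j) \<and> card (\<rho> j) \<le> histogram d r G j)"
  using assms not_in_zero_interval_iff
  unfolding profile_property_def zero_profile_def by blast

text \<open>The bound sums over all types, not just the violated ones, so that it does not depend on
  \<open>G\<close>. Unbounded intervals contribute \<open>0\<close>, the cardinality assigned to
  infinite sets.\<close>

lemma obstruction_to_profiles:
  fixes \<rho> :: "nat \<Rightarrow> nat \<Rightarrow> nat set"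
  assumes \<rho>: "\<And>i. i \<in> I \<Longrightarrow> zero_profile d (r i) (\<rho> i)" and I: "finite I"
    and Gd: "G \<in> deg_class d"
    and GP: "\<And>i. i \<in> I \<Longrightarrow> G \<notin> profile_property d (r i) (\<rho> i)"
  shows "\<exists>S\<subseteq>pverts G.
    card S \<le> (\<Sum>i\<in>I. \<Sum>j\<in>{1..n_rtypes d (r i)}. card (\<rho> i j) * Suc d ^ r i) \<and>
    (\<forall>H\<in>deg_class d. \<forall>f. embedding (marked_part G S) H f \<longrightarrow>
      (\<forall>i\<in>I. H \<notin> profile_property d (r i) (\<rho> i)))"
proof -
  have G: "pair_graph G" using Gd by (simp add: deg_class_def)
  have "\<forall>i\<in>I. \<exists>j. j \<in> {1..n_rtypes d (r i)} \<and> finite (\<rho> i j) \<and>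
      card (\<rho> i j) \<le> histogram d (r i) G j"
    using GP not_in_profile_property_iff[OF \<rho> Gd] by blast
  from bchoice[OF this] obtain j where j: "\<And>i. i \<in> I \<Longrightarrow> j i \<in> {1..n_rtypes d (r i)}"
      "\<And>i. i \<in> I \<Longrightarrow> finite (\<rho> i (j i))"
      "\<And>i. i \<in> I \<Longrightarrow> card (\<rho> i (j i)) \<le> histogram d (r i) G (j i)"
    by blast
  \<comment> \<open>Exactly \<open>card (\<rho> i (j i))\<close> vertices of the violated type
    suffice to exceed the interval.\<close>
  have "\<forall>i\<in>I. \<exists>W. W \<subseteq> {v \<in> pverts G. has_rtype (r i) G v (rtype_enum d (r i) (j i))} \<and>
      card W = card (\<rho> i (j i))"
  proof
    fix i assume "i \<in> I"
    from j(3)[OF this] obtain T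
      where "T \<subseteq> {v \<in> pverts G. has_rtype (r i) G v (rtype_enum d (r i) (j i))}"
        "card T = card (\<rho> i (j i))"
      unfolding histogram_def by (rule obtain_subset_with_card_n)
    then show "\<exists>W. W \<subseteq> {v \<in> pverts G. has_rtype (r i) G v (rtype_enum d (r i) (j i))} \<and>
        card W = card (\<rho> i (j i))"
      by (intro exI conjI)
  qed
  from bchoice[OF this] obtain W where W: "\<And>i. i \<in> I \<Longrightarrow> card (W i) = card (\<rho> i (j i))"
      "\<And>i. i \<in> I \<Longrightarrow> W i \<subseteq> {v \<in> pverts G. has_rtype (r i) G v (rtype_enum d (r i) (j i))}"
    by blast
  define S where "S = (\<Union>i\<in>I. \<Union>w\<in>W i. nbhd (r i) G w)"
  have SG: "S \<subseteq> pverts G" unfolding S_def using nbhd_subset_pverts by blast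
  have finW: "finite (W i)" if "i \<in> I" for i
    using W(2)[OF that] G by (auto simp: pair_graph_iff intro: finite_subset)
  have card_W: "card (\<Union>w\<in>W i. nbhd (r i) G w)
      \<le> (\<Sum>j\<in>{1..n_rtypes d (r i)}. card (\<rho> i j) * Suc d ^ r i)" if "i \<in> I" for i
  proof -
    have "card (\<Union>w\<in>W i. nbhd (r i) G w) \<le> (\<Sum>w\<in>W i. card (nbhd (r i) G w))"
      by (rule card_UN_le[OF finW[OF that]])
    also have "\<dots> \<le> card (W i) * Suc d ^ r i"
      using sum_bounded_above[of "W i" "\<lambda>w. card (nbhd (r i) G w)" "Suc d ^ r i"]
        card_nbhd_le[OF Gd] W(2)[OF that] by auto
    also have "\<dots> = card (\<rho> i (j i)) * Suc d ^ r i" by (simp add: W(1)[OF that])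
    also have "\<dots> \<le> (\<Sum>j\<in>{1..n_rtypes d (r i)}. card (\<rho> i j) * Suc d ^ r i)"
      using j(1)[OF that] by (intro member_le_sum) auto
    finally show ?thesis .
  qed
  have "card S \<le> (\<Sum>i\<in>I. card (\<Union>w\<in>W i. nbhd (r i) G w))"
    unfolding S_def by (rule card_UN_le[OF I])
  also have "\<dots> \<le> (\<Sum>i\<in>I. \<Sum>j\<in>{1..n_rtypes d (r i)}. card (\<rho> i j) * Suc d ^ r i)"
    by (rule sum_mono) (rule card_W)
  finally have card_S: "card S \<le> \<dots>" .
  have "H \<notin> profile_property d (r i) (\<rho> i)"
    if H: "H \<in> deg_class d" and f: "embedding (marked_part G S) H f" and i: "i \<in> I" for H f i
  proof -
    have Hg: "pair_graph H" using H by (simp add: deg_class_def)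
    have sub: "nbhd (r i) G w \<subseteq> S" if "w \<in> W i" for w
      using that i unfolding S_def by blast
    \<comment> \<open>Each selected vertex lies in its own ball, even for radius
      \<open>0\<close>.\<close>
    moreover have "W i \<subseteq> S"
      using sub nbhd_self[OF G] W(2)[OF i] by blast
    ultimately have "card (W i) \<le> histogram d (r i) H (j i)"
      using W(2)[OF i] by (intro embedding_card_le_histogram[OF G Hg SG f j(1)[OF i]]) auto
    then show ?thesis
      using not_in_profile_property_iff[OF \<rho>[OF i] H] j(1,2)[OF i] W(1)[OF i] by auto
  qed
  with SG card_S show ?thesis by blast
qed

theorem theorem3p4:
  fixes d k :: nat
    and r :: "nat \<Rightarrow> nat"
    and \<rho> :: "nat \<Rightarrow> nat \<Rightarrow> nat set"
  assumes "\<And>i. i \<in> {1..k} \<Longrightarrow> zero_profile d (r i) (\<rho> i)"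
  shows "GSF_local d (\<Union>i\<in>{1..k}. profile_property d (r i) (\<rho> i))"
proof -
  define P where "P = (\<Union>i\<in>{1..k}. profile_property d (r i) (\<rho> i))"
  define s where "s = (\<Sum>i\<in>{1..k}. \<Sum>j\<in>{1..n_rtypes d (r i)}. card (\<rho> i j) * Suc d ^ r i)"
  \<comment> \<open>One set serves every order \<open>n\<close>. For \<open>k = 0\<close> it
    contains the empty marked graph, which embeds everywhere, so no graph is free, matching the
    empty union.\<close>
  define \<F> where "\<F> = {M. pair_graph (fst M) \<and> card (pverts (fst M)) \<le> s \<and>
    (\<forall>H\<in>P. \<nexists>f. embedding M H f)}"
  have Pd: "P \<subseteq> deg_class d" by (auto simp: P_def profile_property_def)
  have "G \<in> P" if G: "G \<in> deg_class d" and free: "is_free \<F> G" for G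
  proof (rule ccontr)
    assume "G \<notin> P"
    then have "G \<notin> profile_property d (r i) (\<rho> i)" if "i \<in> {1..k}" for i
      using that by (auto simp: P_def)
    with obstruction_to_profiles[of "{1..k}" d r \<rho> G] assms G
    obtain S where S: "S \<subseteq> pverts G" "card S \<le> s"
      and obs: "\<And>H f i. H \<in> deg_class d \<Longrightarrow> embedding (marked_part G S) H f \<Longrightarrow> i \<in> {1..k} \<Longrightarrow>
        H \<notin> profile_property d (r i) (\<rho> i)"
      unfolding s_def by blast
    have Gg: "pair_graph G" using G by (simp add: deg_class_def)
    have "\<not> embedding (marked_part G S) H f" if "H \<in> P" for H f
      using that obs Pd unfolding P_def by blast
    then have "marked_part G S \<in> \<F>"
      using S pair_graph_pinduce[OF Gg S(1)] by (simp add: \<F>_def marked_part_def)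
    with free embedding_marked_part_id[OF Gg S(1)] show False
      unfolding is_free_def by blast
  qed
  moreover have "is_free \<F> G" if "G \<in> P" for G
    using that by (auto simp: is_free_def \<F>_def)
  ultimately have "GSF_local d P"
    unfolding GSF_local_def using Pd
    by (intro exI[of _ "\<lambda>_. \<F>"] exI[of _ s]) (auto simp: \<F>_def)
  then show ?thesis unfolding P_def .
qed

end
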